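(* Let $d\ge1$ and $\varphi\in GL(d,\mathbb{Z})$. If $G=\mathbb{Z}^d\rtimes_\varphi\mathbb{Z}$ has rank $2$, then the number of Nielsen equivalence classes of generating pairs of $G$ is equal to the index of the subgroup generated by $\varphi$ and $-\mathrm{Id}$ in the centralizer of $\varphi$ in $GL(d,\mathbb{Z})$.
   Context: For a group $A$ and $\varphi\in \mathrm{Aut}(A)$, $A\rtimes_\varphi\mathbb{Z}=\langle A,t\mid tat^{-1}=\varphi(a)\ (a\in A)\rangle$. The rank of a finitely generated group is the minimum cardinality of a generating set. Two generating sets (tuples of the same length) of a group are Nielsen equivalent if one can pass from one to the other by finitely many Nielsen operations: permuting the generators, replacing a generator $g_i$ by $g_i^{-1}$, or replacing $g_i$ by $g_ig_j$ with $j\ne i$. *)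

theory Defs
  imports "HOL-Analysis.Analysis" "HOL-Algebra.Algebra"
begin

text \<open>The group \<open>GL(d,\<int>)\<close>, where \<open>d = CARD('d)\<close>, so that \<open>d \<ge> 1\<close>. The ring is \<open>int\<close>, hence
  \<^const>\<open>invertible\<close> asks for an inverse matrix with integer entries.\<close>

definition GL_int :: "(int ^ 'd ^ 'd::finite) monoid" where
  "GL_int = \<lparr>carrier = {A. invertible A}, mult = (**), one = mat 1\<rparr>"

text \<open>The standard model of \<open>\<int>\<^sup>d \<rtimes>\<^sub>\<phi> \<int>\<close>: the pair \<open>(a, m)\<close> stands for \<open>a t\<^sup>m\<close>, so that \<open>t a t\<inverse> = \<phi> a\<close>.
  That this is the group with the presentation \<open>\<langle>\<int>\<^sup>d, t | t a t\<inverse> = \<phi> a\<rangle>\<close> is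
  shown in \<open>semidirect_relation\<close> and \<open>semidirect_universal\<close> below.\<close>

definition semidirect :: "int ^ 'd ^ 'd::finite \<Rightarrow> ((int ^ 'd) \<times> int) monoid" where
  "semidirect \<phi> =
     \<lparr>carrier = UNIV,
      mult = (\<lambda>(a, m) (b, n). (a + (\<phi> [^]\<^bsub>GL_int\<^esub> m) *v b, m + n)),
      one = (0, 0)\<rparr>"

definition has_rank :: "('a, 'b) monoid_scheme \<Rightarrow> nat \<Rightarrow> bool" where
  "has_rank G r \<longleftrightarrow>
     (\<exists>S \<subseteq> carrier G. finite S \<and> generate G S = carrier G \<and> card S = r) \<and>
     (\<forall>S \<subseteq> carrier G. finite S \<and> generate G S = carrier G \<longrightarrow> r \<le> card S)"

definition generating_tuples :: "('a, 'b) monoid_scheme \<Rightarrow> nat \<Rightarrow> 'a list set" where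
  "generating_tuples G n =
     {xs. length xs = n \<and> set xs \<subseteq> carrier G \<and> generate G (set xs) = carrier G}"

inductive nielsen_op :: "('a, 'b) monoid_scheme \<Rightarrow> 'a list \<Rightarrow> 'a list \<Rightarrow> bool"
  for G (structure) where
  permute: "mset ys = mset xs \<Longrightarrow> nielsen_op G xs ys"
| invert: "i < length xs \<Longrightarrow> nielsen_op G xs (xs[i := inv (xs ! i)])"
| multiply: "i < length xs \<Longrightarrow> j < length xs \<Longrightarrow> j \<noteq> i \<Longrightarrow>
    nielsen_op G xs (xs[i := xs ! i \<otimes> xs ! j])"

definition nielsen_equivalence :: "('a, 'b) monoid_scheme \<Rightarrow> nat \<Rightarrow> ('a list \<times> 'a list) set" where
  "nielsen_equivalence G n =
     {(xs, ys). xs \<in> generating_tuples G n \<and> ys \<in> generating_tuples G n \<and> (nielsen_op G)\<^sup>*\<^sup>* xs ys}"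

text \<open>The set of classes may be infinite, where \<^const>\<open>card\<close> would give \<open>0\<close>; its size, like that of the
  set of cosets whose size is the index of a subgroup, is therefore compared by \<^const>\<open>eqpoll\<close>.\<close>

definition nielsen_classes :: "('a, 'b) monoid_scheme \<Rightarrow> nat \<Rightarrow> 'a list set set" where
  "nielsen_classes G n = generating_tuples G n // nielsen_equivalence G n"

definition centralizer :: "('a, 'b) monoid_scheme \<Rightarrow> 'a \<Rightarrow> ('a, 'b) monoid_scheme" where
  "centralizer G x = G\<lparr>carrier := {y \<in> carrier G. y \<otimes>\<^bsub>G\<^esub> x = x \<otimes>\<^bsub>G\<^esub> y}\<rparr>"

lemma nielsen_op_carrier:
  assumes "group G" "nielsen_op G xs ys" "set xs \<subseteq> carrier G"
  shows "set ys \<subseteq> carrier G"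
proof -
  interpret group G by fact
  have *: "set (xs[i := x]) \<subseteq> carrier G" if "x \<in> carrier G" for i x
    using assms(3) that set_update_subset_insert[of xs i x] by blast
  from assms(2) show ?thesis
  proof cases
    case permute
    then show ?thesis using assms(3) by (metis mset_eq_setD)
  next
    case (invert i)
    then show ?thesis using * assms(3) by (metis inv_closed nth_mem subsetD)
  next
    case (multiply i j)
    then show ?thesis using * assms(3) by (metis m_closed nth_mem subsetD)
  qed
qed

lemma nielsen_op_sym:
  assumes "group G" "nielsen_op G xs ys" "set xs \<subseteq> carrier G"
  shows "(nielsen_op G)\<^sup>*\<^sup>* ys xs"
proof -
  interpret group G by fact
  have xs: "xs ! i \<in> carrier G" if "i < length xs" for i
    using assms(3) that by auto
  from assms(2) show ?thesis
  proof cases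
    case permute
    then show ?thesis by (intro r_into_rtranclp nielsen_op.permute) simp
  next
    case (invert i)
    then have "nielsen_op G ys xs"
      using nielsen_op.invert[of i ys G] xs[of i] by simp
    then show ?thesis by blast
  next
    case (multiply i j)
    let ?y1 = "ys[j := inv\<^bsub>G\<^esub> (xs ! j)]"
    let ?y2 = "xs[j := inv\<^bsub>G\<^esub> (xs ! j)]"
    have "nielsen_op G ys ?y1"
      using nielsen_op.invert[of j ys G] multiply by simp
    moreover have "?y2[i := xs ! i] = ?y2"
      using multiply by (metis list_update_id nth_list_update_neq)
    then have "nielsen_op G ?y1 ?y2"
      using nielsen_op.multiply[of i ?y1 j G] multiply xs[of i] xs[of j]
      by (simp add: m_assoc list_update_swap[of i j])
    moreover have "nielsen_op G ?y2 xs"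
      using nielsen_op.invert[of j ?y2 G] multiply xs[of j] by simp
    ultimately show ?thesis by (meson converse_rtranclp_into_rtranclp rtranclp.rtrancl_refl)
  qed
qed

lemma equiv_nielsen_equivalence:
  assumes "group G"
  shows "equiv (generating_tuples G n) (nielsen_equivalence G n)"
proof (rule equivI)
  have "set ys \<subseteq> carrier G \<and> (nielsen_op G)\<^sup>*\<^sup>* ys xs"
    if "(nielsen_op G)\<^sup>*\<^sup>* xs ys" "set xs \<subseteq> carrier G" for xs ys
    using that
    by (induction rule: rtranclp_induct)
      (auto dest: nielsen_op_carrier[OF assms] nielsen_op_sym[OF assms] intro: rtranclp_trans)
  then show "sym (nielsen_equivalence G n)"
    by (auto intro!: symI simp: nielsen_equivalence_def generating_tuples_def)
  show "trans (nielsen_equivalence G n)"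
    by (auto intro!: transI intro: rtranclp_trans simp: nielsen_equivalence_def)
qed (auto intro!: refl_onI simp: nielsen_equivalence_def)

lemma group_centralizer:
  assumes "group G" and x: "x \<in> carrier G"
  shows "group (centralizer G x)"
proof -
  interpret group G by fact
  have "subgroup {y \<in> carrier G. y \<otimes>\<^bsub>G\<^esub> x = x \<otimes>\<^bsub>G\<^esub> y} G"
  proof (rule subgroupI)
    fix a assume "a \<in> {y \<in> carrier G. y \<otimes>\<^bsub>G\<^esub> x = x \<otimes>\<^bsub>G\<^esub> y}"
    then have a: "a \<in> carrier G" "a \<otimes>\<^bsub>G\<^esub> x = x \<otimes>\<^bsub>G\<^esub> a" by auto
    then have "inv\<^bsub>G\<^esub> a \<otimes>\<^bsub>G\<^esub> x = x \<otimes>\<^bsub>G\<^esub> inv\<^bsub>G\<^esub> a"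
      using x by (metis inv_closed inv_solve_left inv_solve_right m_assoc m_closed)
    then show "inv\<^bsub>G\<^esub> a \<in> {y \<in> carrier G. y \<otimes>\<^bsub>G\<^esub> x = x \<otimes>\<^bsub>G\<^esub> y}"
      using a by simp
  next
    fix a b
    assume "a \<in> {y \<in> carrier G. y \<otimes>\<^bsub>G\<^esub> x = x \<otimes>\<^bsub>G\<^esub> y}" "b \<in> {y \<in> carrier G. y \<otimes>\<^bsub>G\<^esub> x = x \<otimes>\<^bsub>G\<^esub> y}"
    then show "a \<otimes>\<^bsub>G\<^esub> b \<in> {y \<in> carrier G. y \<otimes>\<^bsub>G\<^esub> x = x \<otimes>\<^bsub>G\<^esub> y}"
      using x by simp (metis m_assoc)
  qed (use x in \<open>auto intro!: exI[of _ "\<one>\<^bsub>G\<^esub>"]\<close>)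
  then show ?thesis
    unfolding centralizer_def by (rule subgroup_imp_group)
qed

lemma group_GL_int: "group (GL_int :: (int ^ 'd ^ 'd::finite) monoid)"
proof (rule groupI)
  fix x y :: "int ^ 'd ^ 'd"
  assume "x \<in> carrier GL_int" "y \<in> carrier GL_int"
  then obtain x' y' where "x ** x' = mat 1" "x' ** x = mat 1" "y ** y' = mat 1" "y' ** y = mat 1"
    by (auto simp: GL_int_def invertible_def)
  then have "(x ** y) ** (y' ** x') = mat 1" "(y' ** x') ** (x ** y) = mat 1"
    by (metis matrix_mul_assoc matrix_mul_rid)+
  then show "x \<otimes>\<^bsub>GL_int\<^esub> y \<in> carrier GL_int"
    by (auto simp: GL_int_def invertible_def)
next
  fix x :: "int ^ 'd ^ 'd"
  assume "x \<in> carrier GL_int"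
  then show "\<exists>y\<in>carrier GL_int. y \<otimes>\<^bsub>GL_int\<^esub> x = \<one>\<^bsub>GL_int\<^esub>"
    by (auto simp: GL_int_def invertible_def)
qed (auto simp: GL_int_def matrix_mul_assoc invertible_def intro!: exI[of _ "mat 1"])

lemma one_GL_int: "\<one>\<^bsub>GL_int\<^esub> = mat 1"
  by (simp add: GL_int_def)

lemma carrier_semidirect [simp]: "carrier (semidirect \<phi>) = UNIV"
  and one_semidirect [simp]: "\<one>\<^bsub>semidirect \<phi>\<^esub> = (0, 0)"
  and mult_semidirect [simp]:
    "(a, m) \<otimes>\<^bsub>semidirect \<phi>\<^esub> (b, n) = (a + (\<phi> [^]\<^bsub>GL_int\<^esub> m) *v b, m + n)"
  by (simp_all add: semidirect_def)

context
  fixes \<phi> :: "int ^ 'd ^ 'd::finite"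
  assumes phi: "\<phi> \<in> carrier GL_int"
begin

interpretation GL: group "GL_int :: (int ^ 'd ^ 'd) monoid"
  by (rule group_GL_int)

lemma GL_int_pow_add:
  "\<phi> [^]\<^bsub>GL_int\<^esub> (m + n :: int) = (\<phi> [^]\<^bsub>GL_int\<^esub> m) ** (\<phi> [^]\<^bsub>GL_int\<^esub> n)"
  using GL.int_pow_mult[OF phi, of m n] by (simp add: GL_int_def)

lemma GL_int_pow_one: "\<phi> [^]\<^bsub>GL_int\<^esub> (1 :: int) = \<phi>"
  using phi by simp

lemma group_semidirect: "group (semidirect \<phi>)"
proof (rule groupI)
  fix x y z
  show "x \<otimes>\<^bsub>semidirect \<phi>\<^esub> y \<otimes>\<^bsub>semidirect \<phi>\<^esub> z = x \<otimes>\<^bsub>semidirect \<phi>\<^esub> (y \<otimes>\<^bsub>semidirect \<phi>\<^esub> z)"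
    by (cases x; cases y; cases z)
      (simp add: GL_int_pow_add matrix_vector_mul_assoc matrix_vector_right_distrib)
next
  fix x :: "(int ^ 'd) \<times> int"
  obtain a m where x: "x = (a, m)" by (cases x)
  have "(- ((\<phi> [^]\<^bsub>GL_int\<^esub> (- m)) *v a), - m) \<otimes>\<^bsub>semidirect \<phi>\<^esub> x = \<one>\<^bsub>semidirect \<phi>\<^esub>"
    by (simp add: x)
  then show "\<exists>y\<in>carrier (semidirect \<phi>). y \<otimes>\<^bsub>semidirect \<phi>\<^esub> x = \<one>\<^bsub>semidirect \<phi>\<^esub>"
    by (metis UNIV_I carrier_semidirect)
next
  fix x :: "(int ^ 'd) \<times> int"
  show "\<one>\<^bsub>semidirect \<phi>\<^esub> \<otimes>\<^bsub>semidirect \<phi>\<^esub> x = x"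
    by (cases x) (simp add: one_GL_int)
qed auto

lemma semidirect_relation:
  "(0, 1) \<otimes>\<^bsub>semidirect \<phi>\<^esub> (a, 0) \<otimes>\<^bsub>semidirect \<phi>\<^esub> inv\<^bsub>semidirect \<phi>\<^esub> (0, 1) = (\<phi> *v a, 0)"
proof -
  interpret S: group "semidirect \<phi>" by (rule group_semidirect)
  have "(0, 1) \<otimes>\<^bsub>semidirect \<phi>\<^esub> (a, 0) = (\<phi> *v a, 0) \<otimes>\<^bsub>semidirect \<phi>\<^esub> (0, 1)"
    by (simp add: GL_int_pow_one)
  then show ?thesis
    by (simp add: S.inv_solve_right' del: mult_semidirect)
qed

lemma semidirect_universal:
  fixes H (structure) and f :: "int ^ 'd \<Rightarrow> 'h"
  assumes H: "group H" and t: "t \<in> carrier H"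
    and f: "\<And>a. f a \<in> carrier H" and f_add: "\<And>a b. f (a + b) = f a \<otimes> f b"
    and rel: "\<And>a. t \<otimes> f a \<otimes> inv t = f (\<phi> *v a)"
  shows "\<exists>!F. F \<in> hom (semidirect \<phi>) H \<and> (\<forall>a. F (a, 0) = f a) \<and> F (0, 1) = t"
proof -
  interpret H: group H by (rule H)
  interpret S: group "semidirect \<phi>" by (rule group_semidirect)
  let ?p = "\<lambda>m::int. \<phi> [^]\<^bsub>GL_int\<^esub> m"
  have f0: "f 0 = \<one>"
    using f_add[of 0 0] f H.l_cancel_one' by simp
  have comm1: "t \<otimes> f a = f (\<phi> *v a) \<otimes> t" for a
    unfolding rel[symmetric] using t f by (simp add: H.m_assoc)
  have comm_nat: "t [^] (int n) \<otimes> f a = f (?p (int n) *v a) \<otimes> t [^] (int n)" for n a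
  proof (induction n arbitrary: a)
    case 0
    then show ?case using f by (simp add: one_GL_int)
  next
    case (Suc n)
    have t_pow: "t [^] (int (Suc n)) = t [^] (int n) \<otimes> t"
      by (simp add: int_pow_int del: of_nat_Suc)
    have p_Suc: "?p (int (Suc n)) = ?p (int n) ** \<phi>"
      using GL_int_pow_add[of "int n" 1] by (simp add: GL_int_pow_one add.commute)
    have "t [^] (int (Suc n)) \<otimes> f a = t [^] (int n) \<otimes> (f (\<phi> *v a) \<otimes> t)"
      unfolding t_pow using t f by (simp add: H.m_assoc comm1)
    also have "\<dots> = t [^] (int n) \<otimes> f (\<phi> *v a) \<otimes> t"
      using t f by (simp add: H.m_assoc)
    also have "\<dots> = f (?p (int n) *v (\<phi> *v a)) \<otimes> t [^] (int n) \<otimes> t"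
      by (simp only: Suc.IH)
    also have "\<dots> = f (?p (int (Suc n)) *v a) \<otimes> t [^] (int (Suc n))"
      unfolding t_pow p_Suc using t f by (simp add: H.m_assoc matrix_vector_mul_assoc)
    finally show ?case .
  qed
  have comm: "t [^] m \<otimes> f a = f (?p m *v a) \<otimes> t [^] m" for m :: int and a
  proof (cases "m \<ge> 0")
    case True
    then show ?thesis using comm_nat[of "nat m" a] by simp
  next
    case False
    then have m: "- m = int (nat (- m))" by simp
    have "?p (- m) *v (?p m *v a) = a"
      by (simp add: matrix_vector_mul_assoc one_GL_int flip: GL_int_pow_add)
    then have *: "t [^] (- m) \<otimes> f (?p m *v a) = f a \<otimes> t [^] (- m)"
      using comm_nat[of "nat (- m)" "?p m *v a"] m by simp
    have tt: "t [^] m \<otimes> t [^] (- m) = \<one>" "t [^] (- m) \<otimes> t [^] m = \<one>"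
      using t by (simp_all add: H.int_pow_mult[symmetric])
    have "t [^] m \<otimes> f a = t [^] m \<otimes> (f a \<otimes> (t [^] (- m) \<otimes> t [^] m))"
      using tt f t by simp
    also have "\<dots> = t [^] m \<otimes> (f a \<otimes> t [^] (- m)) \<otimes> t [^] m"
      using f t by (simp add: H.m_assoc)
    also have "\<dots> = (t [^] m \<otimes> t [^] (- m)) \<otimes> f (?p m *v a) \<otimes> t [^] m"
      unfolding *[symmetric] using f t by (simp add: H.m_assoc)
    finally show ?thesis using tt f t by simp
  qed
  define F where "F = (\<lambda>(a, m::int). f a \<otimes> t [^] m)"
  have "F \<in> hom (semidirect \<phi>) H"
  proof (rule homI)
    fix x y :: "(int ^ 'd) \<times> int"
    obtain a m b n where xy: "x = (a, m)" "y = (b, n)" by (cases x; cases y) auto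
    have "F (x \<otimes>\<^bsub>semidirect \<phi>\<^esub> y) = f a \<otimes> (f (?p m *v b) \<otimes> t [^] m) \<otimes> t [^] n"
      using f t by (simp add: xy F_def f_add H.int_pow_mult H.m_assoc)
    also have "\<dots> = F x \<otimes> F y"
      unfolding comm[symmetric] using f t by (simp add: xy F_def H.m_assoc)
    finally show "F (x \<otimes>\<^bsub>semidirect \<phi>\<^esub> y) = F x \<otimes> F y" .
  qed (use f t in \<open>auto simp: F_def\<close>)
  moreover have "(\<forall>a. F (a, 0) = f a) \<and> F (0, 1) = t"
    using f t f0 by (simp add: F_def)
  moreover have "F' = F"
    if F': "F' \<in> hom (semidirect \<phi>) H" and F'f: "\<forall>a. F' (a, 0) = f a" and F't: "F' (0, 1) = t" for F'
  proof
    fix x :: "(int ^ 'd) \<times> int"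
    interpret F': group_hom "semidirect \<phi>" H F'
      using F' by unfold_locales
    have nat_pow: "(0, 1) [^]\<^bsub>semidirect \<phi>\<^esub> n = (0, int n)" for n :: nat
      by (induction n) auto
    have "(0, - k) \<otimes>\<^bsub>semidirect \<phi>\<^esub> (0, k) = \<one>\<^bsub>semidirect \<phi>\<^esub>" for k
      by simp
    then have inv_pow: "inv\<^bsub>semidirect \<phi>\<^esub> (0, k) = (0, - k)" for k
      by (intro S.inv_equality) auto
    have pow: "(0, 1) [^]\<^bsub>semidirect \<phi>\<^esub> m = (0, m)" for m :: int
      by (simp add: int_pow_def2 nat_pow inv_pow)
    obtain a m where x: "x = (a, m)" by (cases x)
    have "x = (a, 0) \<otimes>\<^bsub>semidirect \<phi>\<^esub> (0, 1) [^]\<^bsub>semidirect \<phi>\<^esub> m"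
      by (simp add: x pow)
    then have "F' x = F' (a, 0) \<otimes> F' ((0, 1) [^]\<^bsub>semidirect \<phi>\<^esub> m)"
      by (metis F'.hom_mult UNIV_I carrier_semidirect)
    also have "\<dots> = f a \<otimes> t [^] m"
      using F'f F't F'.hom_int_pow[of "(0,1)" m] by simp
    finally show "F' x = F x" by (simp add: F_def x)
  qed
  ultimately show ?thesis by blast
qed

end

end

theory Submission
  imports Defs
begin

text \<open>Put \<open>p\<^sub>m = (\<phi>\<^sup>m - 1) / (\<phi> - 1)\<close>, a Laurent polynomial in \<open>\<phi>\<close>. For a pair \<open>((a, m), (b, n))\<close> the
  vector \<open>p\<^sub>n a - p\<^sub>m b\<close> changes under a Nielsen operation only by some factor \<open>\<plusminus>\<phi>\<^sup>k\<close>; this follows from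
  \<open>p\<^bsub>m+n\<^esub> = p\<^sub>m + \<phi>\<^sup>m p\<^sub>n\<close>. By Euclid's algorithm, and because conjugating and multiplying
  the generators changes the second one by \<open>\<plusminus>\<phi>\<^sup>k a\<close>, every generating pair is equivalent to some
  \<open>((a, 0), (0, 1))\<close>, whose invariant is \<open>a\<close>; such a pair generates iff \<open>a\<close> is a cyclic vector of
  the \<open>\<int>[\<phi>, \<phi>\<inverse>]\<close>-module \<open>\<int>\<^sup>d\<close>. So the classes are the orbits of \<open>\<langle>\<phi>, -1\<rangle>\<close> on the cyclic vectors. If
  there is a cyclic vector, then every endomorphism of the module is a Laurent
  polynomial in \<open>\<phi>\<close>, and the centralizer acts simply transitively on the cyclic vectors.\<close>

text \<open>When \<open>R\<close> is the kernel relation of \<open>f\<close>, a class has a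
  one-element image under \<open>f\<close>, and \<open>the_elem\<close> extracts it. Using
  \<open>\<approx>\<close> covers infinitely many classes.\<close>

lemma eqpoll_quotient_image:
  assumes "equiv A R" and f: "\<And>x y. x \<in> A \<Longrightarrow> y \<in> A \<Longrightarrow> (x, y) \<in> R \<longleftrightarrow> f x = f y"
  shows "A // R \<approx> f ` A"
proof -
  have im: "f ` (R `` {x}) = {f x}" if "x \<in> A" for x
    using that f equiv_class_self[OF assms(1) that] assms(1) by (auto simp: equiv_def refl_on_def)
  have "bij_betw (\<lambda>C. the_elem (f ` C)) (A // R) (f ` A)"
    unfolding bij_betw_def
  proof
    show "inj_on (\<lambda>C. the_elem (f ` C)) (A // R)"
    proof (rule inj_onI)
      fix C D
      assume CD: "C \<in> A // R" "D \<in> A // R" "the_elem (f ` C) = the_elem (f ` D)"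
      then obtain x y where "x \<in> A" "C = R `` {x}" "y \<in> A" "D = R `` {y}"
        by (auto elim!: quotientE)
      with CD(3) show "C = D"
        using f[of x y] equiv_class_eq[OF assms(1), of x y] by (simp add: im)
    qed
    show "(\<lambda>C. the_elem (f ` C)) ` (A // R) = f ` A"
      by (auto simp: quotient_def image_UN im)
  qed
  then show ?thesis by (auto simp: eqpoll_def)
qed

lemma matrix_vector_mult_minus_right: "A *v (- x) = - (A *v x)"
  for A :: "'a::ring_1 ^ 'n ^ 'm"
  using matrix_vector_mult_diff_distrib[of A 0 x] by simp

lemma matrix_vector_mult_minus_left: "(- A) *v x = - (A *v x)"
  for A :: "'a::ring_1 ^ 'n ^ 'm"
  using matrix_vector_mult_diff_rdistrib[of 0 A x] by simp

section \<open>Nielsen operations on pairs\<close>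

lemma nielsen_op_swap: "nielsen_op G [x, y] [y, x]"
  by (rule nielsen_op.permute) simp

text \<open>Reduces the behaviour of the invariant to six explicit cases.\<close>

lemma nielsen_op_pair_cases:
  assumes "nielsen_op G [x, y] zs"
  shows "zs \<in> {[x, y], [y, x], [inv\<^bsub>G\<^esub> x, y], [x, inv\<^bsub>G\<^esub> y], [x \<otimes>\<^bsub>G\<^esub> y, y], [x, y \<otimes>\<^bsub>G\<^esub> x]}"
  using assms
proof cases
  case permute
  then have "length zs = 2" by (metis size_mset length_Cons list.size(3) numeral_2_eq_2)
  then obtain u v where "zs = [u, v]"
    by (auto simp: numeral_2_eq_2 length_Suc_conv)
  then show ?thesis using permute by (auto simp: add_eq_conv_ex)
next
  case (invert i)
  then show ?thesis by (auto simp: less_Suc_eq)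
next
  case (multiply i j)
  then show ?thesis by (auto simp: less_Suc_eq)
qed

context group
begin

abbreviation nielsen :: "'a list \<Rightarrow> 'a list \<Rightarrow> bool" (infix \<open>\<leadsto>\<close> 50)
  where "nielsen \<equiv> (nielsen_op G)\<^sup>*\<^sup>*"

lemma nielsen_carrier: "xs \<leadsto> ys \<Longrightarrow> set xs \<subseteq> carrier G \<Longrightarrow> set ys \<subseteq> carrier G"
  by (induction rule: rtranclp_induct) (auto dest: nielsen_op_carrier[OF is_group])

lemma nielsen_sym: "xs \<leadsto> ys \<Longrightarrow> set xs \<subseteq> carrier G \<Longrightarrow> ys \<leadsto> xs"
proof (induction rule: rtranclp_induct)
  case (step ys zs)
  then have "zs \<leadsto> ys"
    using nielsen_carrier nielsen_op_sym[OF is_group] by blast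
  with step show ?case by auto
qed simp

lemma nielsen_op_generate_subset:
  assumes "nielsen_op G xs ys"
  shows "set ys \<subseteq> generate G (set xs)"
  using assms
proof cases
  case permute
  then show ?thesis by (metis generate.incl mset_eq_setD subsetI)
next
  case (invert i)
  then show ?thesis
    by (auto intro: generate.intros dest!: set_update_subset_insert[THEN subsetD])
next
  case (multiply i j)
  then have "xs ! i \<otimes> xs ! j \<in> generate G (set xs)"
    by (intro generate.eng generate.incl) auto
  with multiply show ?thesis
    by (auto intro: generate.incl dest!: set_update_subset_insert[THEN subsetD])
qed

lemma nielsen_generate_subset:
  assumes "xs \<leadsto> ys" "set xs \<subseteq> carrier G"
  shows "generate G (set ys) \<subseteq> generate G (set xs)"
  using assms
proof (induction rule: rtranclp_induct)
  case (step ys zs)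
  then have "generate G (set zs) \<subseteq> generate G (set ys)"
    using nielsen_carrier[OF step.hyps(1)]
    by (intro generate_subgroup_incl nielsen_op_generate_subset generate_is_subgroup) auto
  with step show ?case by blast
qed simp

lemma nielsen_generate:
  assumes "xs \<leadsto> ys" "set xs \<subseteq> carrier G"
  shows "generate G (set ys) = generate G (set xs)"
  using nielsen_generate_subset[OF assms]
    nielsen_generate_subset[OF nielsen_sym[OF assms] nielsen_carrier[OF assms]] by (rule equalityI)

lemma nielsen_generating_tuples:
  assumes "xs \<leadsto> ys" "xs \<in> generating_tuples G n"
  shows "ys \<in> generating_tuples G n"
proof -
  have "length ys = length xs"
    using assms(1)
    by (induction rule: rtranclp_induct) (auto elim!: nielsen_op.cases dest: mset_eq_length)
  then show ?thesis
    using assms(2) nielsen_generate[OF assms(1)] nielsen_carrier[OF assms(1)]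
    by (simp add: generating_tuples_def)
qed

lemma nielsen_inv_left: "[x, y] \<leadsto> [inv x, y]"
  using nielsen_op.invert[of 0 "[x, y]" G] by simp

lemma nielsen_inv_right: "[x, y] \<leadsto> [x, inv y]"
  using nielsen_op.invert[of 1 "[x, y]" G] by simp

lemma nielsen_mult_left: "[x, y] \<leadsto> [x \<otimes> y, y]"
  using nielsen_op.multiply[of 0 "[x, y]" 1 G] by simp

lemma nielsen_mult_right: "[x, y] \<leadsto> [x, y \<otimes> x]"
  using nielsen_op.multiply[of 1 "[x, y]" 0 G] by simp

lemma nielsen_div_left:
  assumes "x \<in> carrier G" "y \<in> carrier G"
  shows "[x, y] \<leadsto> [x \<otimes> inv y, y]"
  using rtranclp_trans[OF nielsen_inv_right rtranclp_trans[OF nielsen_mult_left nielsen_inv_right], of x y] assms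
  by simp

lemma nielsen_div_right:
  assumes "x \<in> carrier G" "y \<in> carrier G"
  shows "[x, y] \<leadsto> [x, y \<otimes> inv x]"
  using rtranclp_trans[OF nielsen_inv_left rtranclp_trans[OF nielsen_mult_right nielsen_inv_left], of x y] assms
  by simp

text \<open>As \<open>y \<otimes> x\<close> is the inverse of \<open>inv x \<otimes> inv y\<close>,
  a left multiplication is a right division between two inversions.\<close>

lemma nielsen_premult_left:
  assumes "x \<in> carrier G" "y \<in> carrier G"
  shows "[x, y] \<leadsto> [y \<otimes> x, y]"
  using rtranclp_trans[OF nielsen_inv_left rtranclp_trans[OF nielsen_div_left nielsen_inv_left], of x y] assms
  by (simp add: inv_mult_group)

lemma nielsen_premult_right:
  assumes "x \<in> carrier G" "y \<in> carrier G"
  shows "[x, y] \<leadsto> [x, x \<otimes> y]"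
  using rtranclp_trans[OF nielsen_inv_right rtranclp_trans[OF nielsen_div_right nielsen_inv_right], of x y] assms
  by (simp add: inv_mult_group)

lemma nielsen_conj_left:
  assumes "x \<in> carrier G" "y \<in> carrier G"
  shows "[x, y] \<leadsto> [y \<otimes> x \<otimes> inv y, y]"
  using rtranclp_trans[OF nielsen_premult_left nielsen_div_left, of x y] assms by simp

end

section \<open>Laurent polynomials in a matrix\<close>

text \<open>The ring \<open>\<int>[\<phi>, \<phi>\<inverse>]\<close> as finite signed sums of
  powers. Adding one monomial at a time matches the Nielsen translations below.\<close>

inductive_set laurent :: "int ^ 'd ^ 'd::finite \<Rightarrow> (int ^ 'd ^ 'd) set" for \<phi> where
  laurent_zero: "0 \<in> laurent \<phi>"
| laurent_add: "P \<in> laurent \<phi> \<Longrightarrow> P + \<phi> [^]\<^bsub>GL_int\<^esub> (k :: int) \<in> laurent \<phi>"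
| laurent_diff: "P \<in> laurent \<phi> \<Longrightarrow> P - \<phi> [^]\<^bsub>GL_int\<^esub> (k :: int) \<in> laurent \<phi>"

definition cyclic_vector :: "int ^ 'd ^ 'd::finite \<Rightarrow> int ^ 'd \<Rightarrow> bool" where
  "cyclic_vector \<phi> v \<longleftrightarrow> (\<forall>u. \<exists>P\<in>laurent \<phi>. u = P *v v)"

text \<open>Explicit form of the subgroup generated by \<open>\<phi>\<close> and
  \<open>- mat 1\<close>, as \<open>generate_centralizer\<close> confirms.\<close>

definition signed_powers :: "int ^ 'd ^ 'd::finite \<Rightarrow> (int ^ 'd ^ 'd) set" where
  "signed_powers \<phi> = {M. \<exists>k::int. M = \<phi> [^]\<^bsub>GL_int\<^esub> k \<or> M = - (\<phi> [^]\<^bsub>GL_int\<^esub> k)}"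

text \<open>\<open>(\<phi>\<^sup>m - 1) / (\<phi> - 1)\<close>, also for negative \<open>m\<close> and singular \<open>\<phi> - 1\<close>\<close>

definition geometric :: "int ^ 'd ^ 'd::finite \<Rightarrow> int \<Rightarrow> int ^ 'd ^ 'd" where
  "geometric \<phi> m = (\<Sum>k\<in>{0..<m}. \<phi> [^]\<^bsub>GL_int\<^esub> k) - (\<Sum>k\<in>{m..<0}. \<phi> [^]\<^bsub>GL_int\<^esub> k)"

text \<open>For \<open>[(a, m), (b, n)]\<close> this is the determinant of the rows
  \<open>(a, p_m)\<close> and \<open>(b, p_n)\<close>, where \<open>p_m\<close> stands for
  \<open>geometric \<phi> m\<close>.\<close>

definition invariant :: "int ^ 'd ^ 'd::finite \<Rightarrow> ((int ^ 'd) \<times> int) list \<Rightarrow> int ^ 'd" where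
  "invariant \<phi> xs =
     geometric \<phi> (snd (xs ! 1)) *v fst (xs ! 0) - geometric \<phi> (snd (xs ! 0)) *v fst (xs ! 1)"

context
  fixes \<phi> :: "int ^ 'd ^ 'd::finite"
  assumes phi: "\<phi> \<in> carrier GL_int"
begin

interpretation GL: group "GL_int :: (int ^ 'd ^ 'd) monoid"
  by (rule group_GL_int)

interpretation S: group "semidirect \<phi>"
  by (rule group_semidirect[OF phi])

abbreviation phi_power :: "int \<Rightarrow> int ^ 'd ^ 'd" (\<open>\<Phi>\<close>) where
  "\<Phi> m \<equiv> \<phi> [^]\<^bsub>GL_int\<^esub> m"

lemma phi_power_mult: "\<Phi> m ** \<Phi> n = \<Phi> (m + n)"
  by (simp add: GL_int_pow_add[OF phi])

lemma phi_power_vec: "\<Phi> m *v (\<Phi> n *v a) = \<Phi> (m + n) *v a"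
  by (simp add: matrix_vector_mul_assoc phi_power_mult)

lemmas vec_simps = matrix_vector_mult_minus_right matrix_vector_mult_minus_left
  matrix_vector_right_distrib matrix_vector_mult_diff_distrib
  matrix_vector_mult_add_rdistrib matrix_vector_mult_diff_rdistrib phi_power_vec one_GL_int

lemma commute_phi_power:
  assumes "M ** \<phi> = \<phi> ** M"
  shows "M ** \<Phi> k = \<Phi> k ** M"
proof (induction k rule: int_induct[where k = 0])
  case base
  then show ?case by (simp add: one_GL_int)
next
  case (step1 i)
  then show ?case
    using assms GL_int_pow_add[OF phi, of i 1] by (metis GL_int_pow_one matrix_mul_assoc phi)
next
  case (step2 i)
  have *: "\<Phi> i = \<Phi> (i - 1) ** \<phi>" "\<Phi> (i - 1) = \<Phi> i ** \<Phi> (- 1)" "\<Phi> (- 1) ** \<phi> = mat 1" "\<phi> ** \<Phi> (- 1) = mat 1"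
    using GL_int_pow_add[OF phi, of "i - 1" 1] GL_int_pow_add[OF phi, of i "- 1"]
      GL_int_pow_add[OF phi, of "- 1" 1] GL_int_pow_add[OF phi, of "1" "- 1"]
    by (simp_all add: GL_int_pow_one[OF phi] one_GL_int)
  \<comment> \<open>Multiplying \<open>M ** \<phi> = \<phi> ** M\<close> by the inverse of
    \<open>\<phi>\<close> on both sides carries the induction to negative exponents.\<close>
  have "M ** \<Phi> (- 1) = \<Phi> (- 1) ** (\<phi> ** M) ** \<Phi> (- 1)"
    by (simp add: matrix_mul_assoc *)
  also have "\<dots> = \<Phi> (- 1) ** M ** (\<phi> ** \<Phi> (- 1))"
    by (simp add: assms[symmetric] matrix_mul_assoc)
  finally have "M ** \<Phi> (- 1) = \<Phi> (- 1) ** M" by (simp add: *)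
  then show ?case
    using step2 by (metis *(2) GL_int_pow_add[OF phi] add.commute matrix_mul_assoc)
qed

text \<open>\<open>M\<close> commutes with every power of \<open>\<phi>\<close>, hence acts linearly
  over the Laurent polynomials.\<close>

lemma laurent_commute:
  assumes "P \<in> laurent \<phi>" "M ** \<phi> = \<phi> ** M"
  shows "M *v (P *v v) = P *v (M *v v)"
proof -
  have "M *v (\<Phi> k *v v) = \<Phi> k *v (M *v v)" for k
    by (simp add: matrix_vector_mul_assoc commute_phi_power[OF assms(2)])
  with assms(1) show ?thesis
    by induction (simp_all add: vec_simps)
qed

lemma laurent_commute_phi:
  assumes "P \<in> laurent \<phi>"
  shows "P ** \<phi> = \<phi> ** P"
  unfolding matrix_eq using laurent_commute[OF assms, of \<phi>]
  by (simp flip: matrix_vector_mul_assoc)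

lemma laurent_sum:
  assumes "P \<in> laurent \<phi>" "Q \<in> laurent \<phi>"
  shows "P + Q \<in> laurent \<phi>"
  using assms(2,1)
  by induction (auto simp: add_diff_eq add.assoc[symmetric] intro: laurent.intros)

lemma laurent_uminus: "P \<in> laurent \<phi> \<Longrightarrow> - P \<in> laurent \<phi>"
proof (induction rule: laurent.induct)
  case (laurent_diff P k)
  then show ?case using laurent.laurent_add[of "- P" \<phi> k] by simp
qed (auto intro: laurent.intros simp flip: diff_conv_add_uminus)

lemma laurent_phi_power_mult: "P \<in> laurent \<phi> \<Longrightarrow> \<Phi> k ** P \<in> laurent \<phi>"
proof (induction rule: laurent.induct)
  case laurent_zero
  have "\<Phi> k ** 0 = 0" by (simp add: matrix_eq flip: matrix_vector_mul_assoc)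
  then show ?case by (simp add: laurent.laurent_zero)
next
  case (laurent_add P l)
  have "\<Phi> k ** (P + \<Phi> l) = \<Phi> k ** P + \<Phi> (k + l)"
    by (simp add: matrix_eq vec_simps flip: matrix_vector_mul_assoc)
  with laurent_add show ?case by (simp add: laurent.laurent_add)
next
  case (laurent_diff P l)
  have "\<Phi> k ** (P - \<Phi> l) = \<Phi> k ** P - \<Phi> (k + l)"
    by (simp add: matrix_eq vec_simps flip: matrix_vector_mul_assoc)
  with laurent_diff show ?case by (simp add: laurent.laurent_diff)
qed

section \<open>Geometric sums of powers\<close>

lemma geometric_zero: "geometric \<phi> 0 = 0"
  by (simp add: geometric_def)

lemma geometric_Suc: "geometric \<phi> (m + 1) = geometric \<phi> m + \<Phi> m"
proof (cases "m \<ge> 0")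
  case True
  then have "{0..<m + 1} = insert m {0..<m}" by auto
  with True show ?thesis by (simp add: geometric_def)
next
  case False
  \<comment> \<open>For negative \<open>m\<close> the summand at \<open>m\<close> leaves the
    subtracted sum, so again \<open>\<Phi> m\<close> is gained.\<close>
  then have "{m..<0} = insert m {m + 1..<0}" by auto
  with False show ?thesis by (simp add: geometric_def)
qed

lemma geometric_one: "geometric \<phi> 1 = mat 1"
  using geometric_Suc[of 0] by (simp add: geometric_zero one_GL_int)

text \<open>The cocycle identity behind the invariant. Induction on \<open>n\<close> in both
  directions adds or removes one power at a time, so no division by \<open>\<phi> - 1\<close>
  occurs.\<close>

lemma geometric_add:
  "geometric \<phi> (m + n) *v a = geometric \<phi> m *v a + \<Phi> m *v (geometric \<phi> n *v a)"
proof (induction n rule: int_induct[where k = 0])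
  case base
  then show ?case by (simp add: geometric_zero)
next
  case (step1 i)
  then show ?case
    using geometric_Suc[of "m + i"] geometric_Suc[of i] by (simp add: vec_simps add.assoc)
next
  case (step2 i)
  then show ?case
    using geometric_Suc[of "m + i - 1"] geometric_Suc[of "i - 1"]
    by (simp add: vec_simps algebra_simps)
qed

lemma geometric_minus: "geometric \<phi> (- m) *v a = - (\<Phi> (- m) *v (geometric \<phi> m *v a))"
  using geometric_add[of "- m" m a] by (simp add: geometric_zero add_eq_0_iff)

lemma geometric_laurent: "geometric \<phi> m \<in> laurent \<phi>"
proof (induction m rule: int_induct[where k = 0])
  case (step2 i)
  then show ?case
    using geometric_Suc[of "i - 1"] laurent_diff[of "geometric \<phi> i" \<phi> "i - 1"] by simp
qed (auto simp: geometric_zero geometric_Suc intro: laurent.intros)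

lemma geometric_phi_power: "geometric \<phi> m *v (\<Phi> k *v v) = \<Phi> k *v (geometric \<phi> m *v v)"
  using laurent_commute[OF geometric_laurent commute_phi_power[OF refl, symmetric]] by simp

lemma inv_semidirect: "inv\<^bsub>semidirect \<phi>\<^esub> (a, m) = (- (\<Phi> (- m) *v a), - m)"
  by (rule S.inv_equality) simp_all

lemma snd_mult: "snd (x \<otimes>\<^bsub>semidirect \<phi>\<^esub> y) = snd x + snd y"
  by (cases x; cases y) simp

lemma snd_inv: "snd (inv\<^bsub>semidirect \<phi>\<^esub> x) = - snd x"
  by (cases x) (simp add: inv_semidirect)

section \<open>The invariant of a generating pair\<close>

lemma phi_power_signed [simp]: "\<Phi> k \<in> signed_powers \<phi>" "- \<Phi> k \<in> signed_powers \<phi>"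
  by (auto simp: signed_powers_def)

lemma one_signed: "mat 1 \<in> signed_powers \<phi>"
  using phi_power_signed(1)[of 0] by (simp add: one_GL_int)

lemma signed_powers_mult:
  assumes "M \<in> signed_powers \<phi>" "N \<in> signed_powers \<phi>"
  shows "M ** N \<in> signed_powers \<phi>"
proof -
  have "\<Phi> k ** (- \<Phi> l) = - \<Phi> (k + l)" "(- \<Phi> k) ** \<Phi> l = - \<Phi> (k + l)" "(- \<Phi> k) ** (- \<Phi> l) = \<Phi> (k + l)" for k l
    by (simp_all add: matrix_eq vec_simps flip: matrix_vector_mul_assoc)
  with assms show ?thesis by (auto simp: signed_powers_def phi_power_mult)
qed

lemma signed_powers_inverse:
  assumes "M \<in> signed_powers \<phi>"
  obtains N where "N \<in> signed_powers \<phi>" "N ** M = mat 1" "M ** N = mat 1"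
proof -
  obtain k where k: "M = \<Phi> k \<or> M = - \<Phi> k"
    using assms by (auto simp: signed_powers_def)
  have "\<Phi> (- k) ** \<Phi> k = mat 1" "\<Phi> k ** \<Phi> (- k) = mat 1"
    "(- \<Phi> (- k)) ** (- \<Phi> k) = mat 1" "(- \<Phi> k) ** (- \<Phi> (- k)) = mat 1"
    by (simp_all add: matrix_eq vec_simps flip: matrix_vector_mul_assoc)
  with k that show thesis by (metis phi_power_signed)
qed

lemma invariant_nielsen_op:
  assumes "nielsen_op (semidirect \<phi>) xs ys" "length xs = 2"
  shows "\<exists>M\<in>signed_powers \<phi>. invariant \<phi> ys = M *v invariant \<phi> xs"
proof -
  obtain a m b n where xs: "xs = [(a, m), (b, n)]"
    using assms(2) by (auto simp: numeral_2_eq_2 length_Suc_conv)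
  \<comment> \<open>The factor is \<open>mat 1\<close> for the multiplications and the trivial
    permutation, \<open>- \<Phi> 0\<close> for the swap, and \<open>- \<Phi> (- m)\<close> or
    \<open>- \<Phi> (- n)\<close> for inverting the first or the second generator.\<close>
  have "invariant \<phi> ys \<in> (\<lambda>M. M *v invariant \<phi> xs) ` {mat 1, - \<Phi> 0, - \<Phi> (- m), - \<Phi> (- n)}"
    using nielsen_op_pair_cases[OF assms(1)[unfolded xs]] geometric_add[of m n b] geometric_add[of n m a]
    by (auto simp: xs invariant_def inv_semidirect geometric_minus geometric_phi_power vec_simps)
  then show ?thesis
    using one_signed phi_power_signed by blast
qed

lemma invariant_nielsen:
  assumes "(nielsen_op (semidirect \<phi>))\<^sup>*\<^sup>* xs ys" "xs \<in> generating_tuples (semidirect \<phi>) 2"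
  shows "\<exists>M\<in>signed_powers \<phi>. invariant \<phi> ys = M *v invariant \<phi> xs"
  using assms
proof (induction rule: rtranclp_induct)
  case base
  then show ?case using one_signed by force
next
  case (step ys zs)
  then have "length ys = 2"
    using S.nielsen_generating_tuples by (auto simp: generating_tuples_def)
  then obtain N where "N \<in> signed_powers \<phi>" "invariant \<phi> zs = N *v invariant \<phi> ys"
    using invariant_nielsen_op step.hyps(2) by blast
  with step show ?case
    using signed_powers_mult by (metis matrix_vector_mul_assoc)
qed

lemma invariant_normal_form: "invariant \<phi> [(a, 0), (0, 1)] = a"
  by (simp add: invariant_def geometric_one)

section \<open>Generating pairs and cyclic vectors\<close>

lemma generating_imp_cyclic_vector:
  assumes "generate (semidirect \<phi>) {(a, 0), (b, 1)} = UNIV"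
  shows "cyclic_vector \<phi> a"
proof -
  \<comment> \<open>The powers of \<open>(b, 1)\<close> are
    \<open>(geometric \<phi> n *v b, n)\<close>; \<open>K\<close> multiplies them by Laurent
    multiples of \<open>a\<close>. It is a subgroup containing both generators, and its elements of
    exponent zero are the Laurent multiples of \<open>a\<close>.\<close>
  define K where "K = {(u, n). \<exists>P\<in>laurent \<phi>. u = P *v a + geometric \<phi> n *v b}"
  have "subgroup K (semidirect \<phi>)"
  proof (rule S.subgroupI)
    show "K \<noteq> {}"
      using laurent_zero by (force simp: K_def)
    fix x y assume "x \<in> K" "y \<in> K"
    then obtain P Q m n where PQ: "P \<in> laurent \<phi>" "Q \<in> laurent \<phi>"
      "x = (P *v a + geometric \<phi> m *v b, m)" "y = (Q *v a + geometric \<phi> n *v b, n)"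
      by (auto simp: K_def)
    show "inv\<^bsub>semidirect \<phi>\<^esub> x \<in> K"
      using PQ by (auto simp: K_def inv_semidirect geometric_minus vec_simps simp flip: matrix_vector_mul_assoc
        intro!: bexI[of _ "- (\<Phi> (- m) ** P)"] laurent_uminus laurent_phi_power_mult)
    show "x \<otimes>\<^bsub>semidirect \<phi>\<^esub> y \<in> K"
      using PQ by (auto simp: K_def geometric_add vec_simps simp flip: matrix_vector_mul_assoc
        intro!: bexI[of _ "P + \<Phi> m ** Q"] laurent_sum laurent_phi_power_mult)
  qed simp
  moreover have "(a, 0) \<in> K"
    using laurent_add[OF laurent_zero, of \<phi> 0] by (force simp: K_def geometric_zero one_GL_int)
  moreover have "(b, 1) \<in> K"
    using laurent_zero by (force simp: K_def geometric_one)
  ultimately have "K = UNIV"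
    using S.generate_subgroup_incl[of "{(a, 0), (b, 1)}" K] assms by auto
  then have "(u, 0) \<in> K" for u by simp
  then show ?thesis
    by (auto simp: K_def cyclic_vector_def geometric_zero)
qed

lemma cyclic_vector_imp_generating:
  assumes "cyclic_vector \<phi> a"
  shows "[(a, 0), (0, 1)] \<in> generating_tuples (semidirect \<phi>) 2"
proof -
  define K where "K = generate (semidirect \<phi>) {(a, 0), (0, 1)}"
  interpret K: subgroup K "semidirect \<phi>"
    unfolding K_def by (rule S.generate_is_subgroup) simp
  have gens: "(a, 0) \<in> K" "(0, 1) \<in> K"
    by (auto simp: K_def intro: generate.incl)
  have t: "(0, k) \<in> K" for k
  proof (induction k rule: int_induct[where k = 0])
    case base
    show ?case using K.one_closed by simp
  next
    case (step1 i)
    then show ?case using K.m_closed[OF step1(2) gens(2)] by simp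
  next
    case (step2 i)
    then show ?case using K.m_closed[OF step2(2) K.m_inv_closed[OF gens(2)]] by (simp add: inv_semidirect)
  qed
  \<comment> \<open>Conjugation of \<open>(a, 0)\<close> by \<open>(0, k)\<close>.\<close>
  have phi_a: "(\<Phi> k *v a, 0) \<in> K" for k
    using K.m_closed[OF K.m_closed[OF t[of k] gens(1)] t[of "- k"]] by simp
  then have phi_a': "(- (\<Phi> k *v a), 0) \<in> K" for k
    using K.m_inv_closed[OF phi_a[of k]] by (simp add: inv_semidirect one_GL_int)
  have laurent_a: "(P *v a, 0) \<in> K" if "P \<in> laurent \<phi>" for P
    using that
  proof induction
    case laurent_zero
    show ?case using K.one_closed by simp
  next
    case (laurent_add P k)
    then show ?case using K.m_closed[OF laurent_add.IH phi_a[of k]] by (simp add: vec_simps)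
  next
    case (laurent_diff P k)
    then show ?case using K.m_closed[OF laurent_diff.IH phi_a'[of k]] by (simp add: vec_simps)
  qed
  have "(u, k) \<in> K" for u k
  proof -
    obtain P where "P \<in> laurent \<phi>" "u = P *v a"
      using assms by (auto simp: cyclic_vector_def)
    then show ?thesis using K.m_closed[OF laurent_a t[of k], of P] by (simp add: one_GL_int)
  qed
  then have "K = UNIV" by auto
  then show ?thesis by (simp add: generating_tuples_def K_def)
qed

section \<open>Reduction to the normal form\<close>

lemma nielsen_euclid_nonneg:
  assumes "snd x \<ge> 0" "snd y \<ge> 0"
  shows "\<exists>x' y'. (nielsen_op (semidirect \<phi>))\<^sup>*\<^sup>* [x, y] [x', y'] \<and> snd x' = 0"
  using assms
\<comment> \<open>Euclid's algorithm by subtraction: dividing by the generator with the smaller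
  positive exponent lowers the sum of the exponents and keeps both nonnegative.\<close>
proof (induction "nat (snd x + snd y)" arbitrary: x y rule: less_induct)
  case less
  consider "snd x = 0" | "snd y = 0" | "0 < snd x" "snd x \<le> snd y" | "0 < snd y" "snd y \<le> snd x"
    using less.prems by linarith
  then show ?case
  proof cases
    case 1
    then show ?thesis by blast
  next
    case 2
    then show ?thesis using nielsen_op_swap by (metis r_into_rtranclp)
  next
    case 3
    have "\<exists>x' y'. (nielsen_op (semidirect \<phi>))\<^sup>*\<^sup>* [x, y \<otimes>\<^bsub>semidirect \<phi>\<^esub> inv\<^bsub>semidirect \<phi>\<^esub> x] [x', y'] \<and> snd x' = 0"
      by (rule less.hyps) (use 3 in \<open>auto simp: snd_mult snd_inv\<close>)
    then show ?thesis using S.nielsen_div_right[of x y] by (auto intro: rtranclp_trans)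
  next
    case 4
    have "\<exists>x' y'. (nielsen_op (semidirect \<phi>))\<^sup>*\<^sup>* [x \<otimes>\<^bsub>semidirect \<phi>\<^esub> inv\<^bsub>semidirect \<phi>\<^esub> y, y] [x', y'] \<and> snd x' = 0"
      by (rule less.hyps) (use 4 in \<open>auto simp: snd_mult snd_inv\<close>)
    then show ?thesis using S.nielsen_div_left[of x y] by (auto intro: rtranclp_trans)
  qed
qed

lemma nielsen_euclid: "\<exists>x' y'. (nielsen_op (semidirect \<phi>))\<^sup>*\<^sup>* [x, y] [x', y'] \<and> snd x' = 0"
proof -
  have x: "\<exists>x'. (nielsen_op (semidirect \<phi>))\<^sup>*\<^sup>* [x, y] [x', y] \<and> snd x' \<ge> 0" for x y
    using S.nielsen_inv_left[of x y] snd_inv[of x] by (metis linear neg_0_le_iff_le rtranclp.rtrancl_refl)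
  have y: "\<exists>y'. (nielsen_op (semidirect \<phi>))\<^sup>*\<^sup>* [x, y] [x, y'] \<and> snd y' \<ge> 0" for x y
    using S.nielsen_inv_right[of x y] snd_inv[of y] by (metis linear neg_0_le_iff_le rtranclp.rtrancl_refl)
  from x[of x y] y obtain x' y' where "(nielsen_op (semidirect \<phi>))\<^sup>*\<^sup>* [x, y] [x', y']" "snd x' \<ge> 0" "snd y' \<ge> 0"
    by (meson rtranclp_trans)
  with nielsen_euclid_nonneg[of x' y'] show ?thesis by (meson rtranclp_trans)
qed

text \<open>Conjugating by \<open>(b, 1)\<close> applies \<open>\<phi>\<close> whatever
  \<open>b\<close> is, because the vectors form an abelian group; negative \<open>k\<close> uses the
  reversed steps.\<close>

lemma nielsen_phi_power:
  "(nielsen_op (semidirect \<phi>))\<^sup>*\<^sup>* [(a, 0), (b, 1)] [(\<Phi> k *v a, 0), (b, 1)]"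
proof -
  have conj: "(b, 1) \<otimes>\<^bsub>semidirect \<phi>\<^esub> (c, 0) \<otimes>\<^bsub>semidirect \<phi>\<^esub> inv\<^bsub>semidirect \<phi>\<^esub> (b, 1) = (\<Phi> 1 *v c, 0)" for c
    by (simp add: inv_semidirect vec_simps del: group.int_pow_1)
  have step: "(nielsen_op (semidirect \<phi>))\<^sup>*\<^sup>* [(\<Phi> i *v a, 0), (b, 1)] [(\<Phi> (i + 1) *v a, 0), (b, 1)]" for i
    using S.nielsen_conj_left[of "(\<Phi> i *v a, 0)" "(b, 1)"]
    by (simp only: conj phi_power_vec carrier_semidirect UNIV_I add.commute[of 1] simp_thms)
  show ?thesis
  proof (induction k rule: int_induct[where k = 0])
    case base
    then show ?case by (simp add: one_GL_int)
  next
    case (step1 i)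
    show ?case using step1.IH step[of i] by (rule rtranclp_trans)
  next
    case (step2 i)
    then show ?case using S.nielsen_sym[OF step[of "i - 1"]] by (auto intro: rtranclp_trans)
  qed
qed

lemma nielsen_signed_power:
  assumes "M \<in> signed_powers \<phi>"
  shows "(nielsen_op (semidirect \<phi>))\<^sup>*\<^sup>* [(a, 0), (b, 1)] [(M *v a, 0), (b, 1)]"
proof -
  obtain k where k: "M = \<Phi> k \<or> M = - \<Phi> k"
    using assms by (auto simp: signed_powers_def)
  have "(nielsen_op (semidirect \<phi>))\<^sup>*\<^sup>* [(\<Phi> k *v a, 0), (b, 1)] [(- (\<Phi> k *v a), 0), (b, 1)]"
    using S.nielsen_inv_left[of "(\<Phi> k *v a, 0)" "(b, 1)"] by (simp add: inv_semidirect one_GL_int)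
  with nielsen_phi_power[of a b k] k show ?thesis
    by (auto simp: vec_simps)
qed

text \<open>Replace \<open>a\<close> by \<open>M *v a\<close>, multiply the second generator by it
  on the left, then turn \<open>M *v a\<close> back into \<open>a\<close>.\<close>

lemma nielsen_translate_signed_power:
  assumes "M \<in> signed_powers \<phi>"
  shows "(nielsen_op (semidirect \<phi>))\<^sup>*\<^sup>* [(a, 0), (b, 1)] [(a, 0), (M *v a + b, 1)]"
proof -
  have "(nielsen_op (semidirect \<phi>))\<^sup>*\<^sup>* [(M *v a, 0), (b, 1)] [(M *v a, 0), (M *v a + b, 1)]"
    using S.nielsen_premult_right[of "(M *v a, 0)" "(b, 1)"] by (simp add: one_GL_int)
  moreover have "(nielsen_op (semidirect \<phi>))\<^sup>*\<^sup>* [(M *v a, 0), (M *v a + b, 1)] [(a, 0), (M *v a + b, 1)]"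
    using S.nielsen_sym[OF nielsen_signed_power[OF assms]] by simp
  ultimately show ?thesis
    using nielsen_signed_power[OF assms] by (meson rtranclp_trans)
qed

text \<open>Each monomial of \<open>P\<close> is added by the preceding lemma, with the current
  translate in the role of \<open>b\<close>.\<close>

lemma nielsen_translate:
  assumes "P \<in> laurent \<phi>"
  shows "(nielsen_op (semidirect \<phi>))\<^sup>*\<^sup>* [(a, 0), (b, 1)] [(a, 0), (P *v a + b, 1)]"
  using assms
proof induction
  case (laurent_add P k)
  show ?case
    using rtranclp_trans[OF laurent_add.IH nielsen_translate_signed_power[OF phi_power_signed(1)[of k]]]
    by (simp add: vec_simps algebra_simps)
next
  case (laurent_diff P k)
  show ?case
    using rtranclp_trans[OF laurent_diff.IH nielsen_translate_signed_power[OF phi_power_signed(2)[of k]]]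
    by (simp add: vec_simps algebra_simps)
qed simp

text \<open>The exponent is a homomorphism to \<open>\<int>\<close>. This will force the exponent
  left by Euclid's algorithm to be a unit.\<close>

lemma dvd_snd_generate:
  assumes "\<And>x. x \<in> A \<Longrightarrow> d dvd snd x" "z \<in> generate (semidirect \<phi>) A"
  shows "d dvd snd z"
  using assms(2) by induction (auto simp: snd_mult snd_inv assms(1))

lemma nielsen_normal_form:
  assumes "xs \<in> generating_tuples (semidirect \<phi>) 2"
  shows "\<exists>a. cyclic_vector \<phi> a \<and> (nielsen_op (semidirect \<phi>))\<^sup>*\<^sup>* xs [(a, 0), (0, 1)]"
proof -
  obtain x y where xs: "xs = [x, y]"
    using assms by (auto simp: generating_tuples_def numeral_2_eq_2 length_Suc_conv)
  obtain a b n where 1: "(nielsen_op (semidirect \<phi>))\<^sup>*\<^sup>* xs [(a, 0), (b, n)]"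
    using nielsen_euclid[of x y] unfolding xs by (metis prod.collapse)
  have "(0, 1) \<in> generate (semidirect \<phi>) {(a, 0), (b, n)}"
    using S.nielsen_generating_tuples[OF 1 assms] by (simp add: generating_tuples_def)
  then have "n dvd snd (0 :: int ^ 'd, 1 :: int)"
    by (rule dvd_snd_generate[rotated]) auto
  then have "n = 1 \<or> n = - 1" by auto
  then obtain c where "(nielsen_op (semidirect \<phi>))\<^sup>*\<^sup>* [(a, 0), (b, n)] [(a, 0), (c, 1)]"
    using S.nielsen_inv_right[of "(a, 0)" "(b, n)"] by (auto simp: inv_semidirect)
  with 1 have 2: "(nielsen_op (semidirect \<phi>))\<^sup>*\<^sup>* xs [(a, 0), (c, 1)]"
    by (rule rtranclp_trans)
  then have cyc: "cyclic_vector \<phi> a"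
    using S.nielsen_generating_tuples[OF 2 assms] generating_imp_cyclic_vector[of a c]
    by (simp add: generating_tuples_def)
  \<comment> \<open>Since \<open>a\<close> is cyclic, \<open>- c\<close> is a Laurent multiple of
    \<open>a\<close>, so a translation clears \<open>c\<close>.\<close>
  then obtain P where "P \<in> laurent \<phi>" "- c = P *v a"
    by (auto simp: cyclic_vector_def)
  then have "(nielsen_op (semidirect \<phi>))\<^sup>*\<^sup>* [(a, 0), (c, 1)] [(a, 0), (0, 1)]"
    using nielsen_translate[of P a c] by (simp flip: \<open>- c = P *v a\<close>)
  with 2 cyc show ?thesis by (meson rtranclp_trans)
qed

text \<open>Cyclic vectors correspond to generating normal forms, and those of \<open>a\<close> and
  \<open>M *v a\<close> are linked by Nielsen operations.\<close>

lemma cyclic_vector_signed_power: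
  assumes "cyclic_vector \<phi> a" "M \<in> signed_powers \<phi>"
  shows "cyclic_vector \<phi> (M *v a)"
proof -
  have "[(M *v a, 0), (0, 1)] \<in> generating_tuples (semidirect \<phi>) 2"
    using nielsen_signed_power[OF assms(2)] cyclic_vector_imp_generating[OF assms(1)]
    by (rule S.nielsen_generating_tuples)
  then show ?thesis
    using generating_imp_cyclic_vector[of "M *v a" 0] by (simp add: generating_tuples_def)
qed

section \<open>Completeness of the invariant\<close>

lemma cyclic_vector_invariant:
  assumes "xs \<in> generating_tuples (semidirect \<phi>) 2"
  shows "cyclic_vector \<phi> (invariant \<phi> xs)"
proof -
  obtain a where a: "cyclic_vector \<phi> a" "(nielsen_op (semidirect \<phi>))\<^sup>*\<^sup>* xs [(a, 0), (0, 1)]"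
    using nielsen_normal_form[OF assms] by blast
  \<comment> \<open>The reversed chain starts at the normal form, whose invariant is
    \<open>a\<close>.\<close>
  have "(nielsen_op (semidirect \<phi>))\<^sup>*\<^sup>* [(a, 0), (0, 1)] xs"
    using S.nielsen_sym[OF a(2)] assms by (simp add: generating_tuples_def)
  then obtain M where "M \<in> signed_powers \<phi>" "invariant \<phi> xs = M *v a"
    using invariant_nielsen cyclic_vector_imp_generating[OF a(1)] invariant_normal_form by metis
  then show ?thesis using cyclic_vector_signed_power a(1) by simp
qed

lemma nielsen_equivalence_iff:
  assumes xs: "xs \<in> generating_tuples (semidirect \<phi>) 2" and ys: "ys \<in> generating_tuples (semidirect \<phi>) 2"
  shows "(xs, ys) \<in> nielsen_equivalence (semidirect \<phi>) 2 \<longleftrightarrow>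
    (\<exists>M\<in>signed_powers \<phi>. invariant \<phi> ys = M *v invariant \<phi> xs)" (is "?L \<longleftrightarrow> ?R")
proof
  assume ?L
  then show ?R using invariant_nielsen xs by (auto simp: nielsen_equivalence_def)
next
  assume ?R
  then obtain M where M: "M \<in> signed_powers \<phi>" "invariant \<phi> ys = M *v invariant \<phi> xs" by blast
  obtain a where a: "cyclic_vector \<phi> a" "(nielsen_op (semidirect \<phi>))\<^sup>*\<^sup>* xs [(a, 0), (0, 1)]"
    using nielsen_normal_form[OF xs] by blast
  obtain b where b: "cyclic_vector \<phi> b" "(nielsen_op (semidirect \<phi>))\<^sup>*\<^sup>* ys [(b, 0), (0, 1)]"
    using nielsen_normal_form[OF ys] by blast
  obtain A where A: "A \<in> signed_powers \<phi>" "a = A *v invariant \<phi> xs"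
    using invariant_nielsen[OF a(2) xs] by (auto simp: invariant_normal_form)
  obtain B where B: "B \<in> signed_powers \<phi>" "b = B *v invariant \<phi> ys"
    using invariant_nielsen[OF b(2) ys] by (auto simp: invariant_normal_form)
  obtain A' where A': "A' \<in> signed_powers \<phi>" "A' ** A = mat 1"
    using signed_powers_inverse[OF A(1)] .
  \<comment> \<open>\<open>A'\<close> leads from \<open>a\<close> back to the invariant of
    \<open>xs\<close>, \<open>M\<close> to that of \<open>ys\<close>, and \<open>B\<close> on to
    \<open>b\<close>; so a signed power links the two normal forms.\<close>
  have "b = (B ** (M ** A')) *v a"
    using A' by (simp add: A B M matrix_vector_mul_assoc flip: matrix_mul_assoc)
  moreover have "B ** (M ** A') \<in> signed_powers \<phi>"
    using A' B M by (simp add: signed_powers_mult)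
  ultimately have "(nielsen_op (semidirect \<phi>))\<^sup>*\<^sup>* [(a, 0), (0, 1)] [(b, 0), (0, 1)]"
    using nielsen_signed_power by metis
  moreover have "(nielsen_op (semidirect \<phi>))\<^sup>*\<^sup>* [(b, 0), (0, 1)] ys"
    using S.nielsen_sym[OF b(2)] ys by (simp add: generating_tuples_def)
  ultimately show ?L
    using a(2) xs ys by (auto simp: nielsen_equivalence_def intro: rtranclp_trans)
qed

section \<open>The centralizer\<close>

interpretation C: group "centralizer GL_int \<phi>"
  by (rule group_centralizer[OF group_GL_int phi])

lemma carrier_centralizer_iff:
  "M \<in> carrier (centralizer GL_int \<phi>) \<longleftrightarrow> invertible M \<and> M ** \<phi> = \<phi> ** M"
  by (simp add: centralizer_def GL_int_def)

lemma mult_centralizer: "M \<otimes>\<^bsub>centralizer GL_int \<phi>\<^esub> N = M ** N"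
  and one_centralizer: "\<one>\<^bsub>centralizer GL_int \<phi>\<^esub> = mat 1"
  by (simp_all add: centralizer_def GL_int_def)

lemma signed_powers_centralizer:
  assumes "M \<in> signed_powers \<phi>"
  shows "M \<in> carrier (centralizer GL_int \<phi>)"
proof -
  have "invertible M"
    using signed_powers_inverse[OF assms] unfolding invertible_def by metis
  have "\<Phi> k ** \<phi> = \<phi> ** \<Phi> k" for k
    using commute_phi_power[of \<phi>] by simp
  moreover have "(- \<Phi> k) ** \<phi> = \<phi> ** (- \<Phi> k)" for k
    using calculation[of k] by (simp add: matrix_eq vec_simps flip: matrix_vector_mul_assoc)
  ultimately show ?thesis
    using assms \<open>invertible M\<close> by (auto simp: carrier_centralizer_iff signed_powers_def)
qed

text \<open>Signed powers form a subgroup containing both generators; conversely every power is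
  generated, and multiplying by \<open>- mat 1\<close> supplies the signs.\<close>

lemma generate_centralizer:
  "generate (centralizer GL_int \<phi>) {\<phi>, - mat 1} = signed_powers \<phi>"
proof
  have phi_signed: "\<phi> \<in> signed_powers \<phi>" "- mat 1 \<in> signed_powers \<phi>"
    using phi_power_signed(1)[of 1] phi_power_signed(2)[of 0]
    by (simp_all add: GL_int_pow_one[OF phi] one_GL_int)
  have inv: "inv\<^bsub>centralizer GL_int \<phi>\<^esub> M \<in> signed_powers \<phi>" if M: "M \<in> signed_powers \<phi>" for M
  proof -
    obtain N where N: "N \<in> signed_powers \<phi>" "N ** M = mat 1"
      using signed_powers_inverse[OF M] .
    then have "inv\<^bsub>centralizer GL_int \<phi>\<^esub> M = N"
      using M by (intro C.inv_equality) (auto simp: mult_centralizer one_centralizer signed_powers_centralizer)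
    with N show ?thesis by simp
  qed
  have "subgroup (signed_powers \<phi>) (centralizer GL_int \<phi>)"
    by (rule C.subgroupI)
      (use phi_signed signed_powers_centralizer inv in \<open>auto simp: mult_centralizer signed_powers_mult\<close>)
  then show "generate (centralizer GL_int \<phi>) {\<phi>, - mat 1} \<subseteq> signed_powers \<phi>"
    using phi_signed by (intro C.generate_subgroup_incl) auto
  interpret H: subgroup "generate (centralizer GL_int \<phi>) {\<phi>, - mat 1}" "centralizer GL_int \<phi>"
    using phi_signed signed_powers_centralizer by (intro C.generate_is_subgroup) auto
  let ?H = "generate (centralizer GL_int \<phi>) {\<phi>, - mat 1}"
  have gens: "\<phi> \<in> ?H" "- mat 1 \<in> ?H"
    by (auto intro: generate.incl)
  have "inv\<^bsub>centralizer GL_int \<phi>\<^esub> \<phi> = \<Phi> (- 1)"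
    using phi_signed GL_int_pow_add[OF phi, of "- 1" 1] signed_powers_centralizer
    by (intro C.inv_equality) (auto simp: mult_centralizer one_centralizer one_GL_int GL_int_pow_one[OF phi])
  then have inv_phi: "\<Phi> (- 1) \<in> ?H"
    using H.m_inv_closed[OF gens(1)] by simp
  have pow: "\<Phi> k \<in> ?H" for k
  proof (induction k rule: int_induct[where k = 0])
    case base
    then show ?case using H.one_closed by (simp add: one_centralizer one_GL_int)
  next
    case (step1 i)
    then show ?case using H.m_closed[OF step1(2) gens(1)]
      by (simp add: mult_centralizer GL_int_pow_add[OF phi] GL_int_pow_one[OF phi])
  next
    case (step2 i)
    then show ?case using H.m_closed[OF step2(2) inv_phi]
      by (simp add: mult_centralizer phi_power_mult)
  qed
  moreover have "- \<Phi> k \<in> ?H" for k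
  proof -
    have "(- mat 1) ** \<Phi> k = - \<Phi> k"
      by (simp add: matrix_eq vec_simps flip: matrix_vector_mul_assoc)
    then show ?thesis using H.m_closed[OF gens(2) pow[of k]] by (simp add: mult_centralizer)
  qed
  ultimately show "signed_powers \<phi> \<subseteq> ?H"
    by (auto simp: signed_powers_def)
qed

section \<open>The action of the centralizer on cyclic vectors\<close>

lemma centralizer_eqI:
  assumes "cyclic_vector \<phi> a" "M ** \<phi> = \<phi> ** M" "N ** \<phi> = \<phi> ** N" "M *v a = N *v a"
  shows "M = N"
proof -
  have "M *v u = N *v u" for u
  proof -
    obtain P where "P \<in> laurent \<phi>" "u = P *v a"
      using assms(1) by (auto simp: cyclic_vector_def)
    \<comment> \<open>Both matrices commute with \<open>P\<close>, so agreement at \<open>a\<close>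
      passes to \<open>P *v a\<close>.\<close>
    then show ?thesis using laurent_commute assms(2-4) by metis
  qed
  then show ?thesis by (simp add: matrix_eq)
qed

text \<open>Laurent polynomials \<open>P\<close> and \<open>Q\<close> carry \<open>a\<close> to
  \<open>b\<close> and back. \<open>Q ** P\<close> fixes \<open>a\<close> and \<open>P ** Q\<close>
  fixes \<open>b\<close>, so both are the identity by uniqueness, and \<open>P\<close> is invertible
  over \<open>\<int>\<close>.\<close>

lemma centralizer_transitive:
  assumes a: "cyclic_vector \<phi> a" and b: "cyclic_vector \<phi> b"
  obtains M where "M \<in> carrier (centralizer GL_int \<phi>)" "M *v a = b"
proof -
  obtain P where P: "P \<in> laurent \<phi>" "b = P *v a"
    using a by (auto simp: cyclic_vector_def)
  obtain Q where Q: "Q \<in> laurent \<phi>" "a = Q *v b"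
    using b by (auto simp: cyclic_vector_def)
  note comm = laurent_commute_phi[OF P(1)] laurent_commute_phi[OF Q(1)]
  have "(Q ** P) ** \<phi> = \<phi> ** (Q ** P)" "(P ** Q) ** \<phi> = \<phi> ** (P ** Q)"
    using comm by (metis matrix_mul_assoc)+
  moreover have "(Q ** P) *v a = mat 1 *v a" "(P ** Q) *v b = mat 1 *v b"
    using P Q by (simp_all flip: matrix_vector_mul_assoc)
  ultimately have "Q ** P = mat 1" "P ** Q = mat 1"
    using centralizer_eqI[OF a] centralizer_eqI[OF b] by (metis matrix_mul_lid matrix_mul_rid)+
  then have "P \<in> carrier (centralizer GL_int \<phi>)"
    using comm by (auto simp: carrier_centralizer_iff invertible_def)
  with P that show thesis by simp
qed

lemma cyclic_vector_centralizer:
  assumes "cyclic_vector \<phi> a" "M \<in> carrier (centralizer GL_int \<phi>)"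
  shows "cyclic_vector \<phi> (M *v a)"
  unfolding cyclic_vector_def
proof
  fix u
  obtain N where N: "M ** N = mat 1" and M: "M ** \<phi> = \<phi> ** M"
    using assms(2) by (auto simp: carrier_centralizer_iff invertible_def)
  \<comment> \<open>Expanding the preimage of \<open>u\<close> under \<open>M\<close> in terms of
    \<open>a\<close> yields an expansion of \<open>u\<close> in terms of
    \<open>M *v a\<close>.\<close>
  obtain P where P: "P \<in> laurent \<phi>" "N *v u = P *v a"
    using assms(1) by (auto simp: cyclic_vector_def)
  have "u = M *v (N *v u)"
    by (simp add: N matrix_vector_mul_assoc)
  also have "\<dots> = P *v (M *v a)"
    by (simp add: P laurent_commute[OF P(1) M])
  finally show "\<exists>P\<in>laurent \<phi>. u = P *v (M *v a)"
    using P(1) by blast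
qed

text \<open>The rank hypothesis enters here: two generators, listed as a pair, have a cyclic
  invariant.\<close>

lemma cyclic_vector_exists:
  assumes "has_rank (semidirect \<phi>) 2"
  obtains a where "cyclic_vector \<phi> a"
proof -
  obtain A where "generate (semidirect \<phi>) A = UNIV" "card A = 2"
    using assms by (auto simp: has_rank_def)
  then obtain x y where "[x, y] \<in> generating_tuples (semidirect \<phi>) 2"
    by (auto simp: card_2_iff generating_tuples_def)
  then show thesis
    using cyclic_vector_invariant that by blast
qed

text \<open>An element of the centralizer is determined by its value at \<open>a\<close>, so
  membership in a coset can be tested there. The set depends on \<open>M\<close> only through
  \<open>M *v a\<close>, hence can be read off from an invariant.\<close>

lemma r_coset_centralizer_eq:
  assumes a: "cyclic_vector \<phi> a" and M: "M \<in> carrier (centralizer GL_int \<phi>)"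
  shows "signed_powers \<phi> #>\<^bsub>centralizer GL_int \<phi>\<^esub> M =
    {N \<in> carrier (centralizer GL_int \<phi>). \<exists>S\<in>signed_powers \<phi>. N *v a = S *v (M *v a)}"
proof (intro equalityI subsetI)
  fix N assume "N \<in> signed_powers \<phi> #>\<^bsub>centralizer GL_int \<phi>\<^esub> M"
  then obtain S where "S \<in> signed_powers \<phi>" "N = S \<otimes>\<^bsub>centralizer GL_int \<phi>\<^esub> M"
    by (auto simp: r_coset_def)
  then show "N \<in> {N \<in> carrier (centralizer GL_int \<phi>). \<exists>S\<in>signed_powers \<phi>. N *v a = S *v (M *v a)}"
    using C.m_closed[OF signed_powers_centralizer M]
    by (auto simp: mult_centralizer matrix_vector_mul_assoc)
next
  fix N assume "N \<in> {N \<in> carrier (centralizer GL_int \<phi>). \<exists>S\<in>signed_powers \<phi>. N *v a = S *v (M *v a)}"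
  then obtain S where S: "N \<in> carrier (centralizer GL_int \<phi>)" "S \<in> signed_powers \<phi>" "N *v a = (S ** M) *v a"
    by (auto simp: matrix_vector_mul_assoc)
  have "S ** M \<in> carrier (centralizer GL_int \<phi>)"
    using C.m_closed[OF signed_powers_centralizer[OF S(2)] M] by (simp add: mult_centralizer)
  then have "N = S ** M"
    using S unfolding carrier_centralizer_iff by (blast intro: centralizer_eqI[OF a])
  then show "N \<in> signed_powers \<phi> #>\<^bsub>centralizer GL_int \<phi>\<^esub> M"
    using S(2) by (auto simp: r_coset_def mult_centralizer)
qed

end

theorem corollary4p4:
  fixes \<phi> :: "int ^ 'd ^ 'd::finite"
  assumes "\<phi> \<in> carrier GL_int"
    and "has_rank (semidirect \<phi>) 2"
  shows "nielsen_classes (semidirect \<phi>) 2 \<approx>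
    rcosets\<^bsub>centralizer GL_int \<phi>\<^esub> (generate (centralizer GL_int \<phi>) {\<phi>, - mat 1})"
proof -
  note phi = assms(1)
  let ?C = "centralizer GL_int \<phi>"
  let ?T = "generating_tuples (semidirect \<phi>) 2"
  obtain a where a: "cyclic_vector \<phi> a"
    using cyclic_vector_exists[OF assms] .
  \<comment> \<open>The coset attached to a pair, defined without choosing an \<open>M\<close> with
    \<open>M *v a = invariant \<phi> xs\<close>.\<close>
  define F where "F xs = {N \<in> carrier ?C. \<exists>S\<in>signed_powers \<phi>. N *v a = S *v invariant \<phi> xs}" for xs
  have coset: "\<exists>M\<in>carrier ?C. M *v a = invariant \<phi> xs \<and> F xs = signed_powers \<phi> #>\<^bsub>?C\<^esub> M" if xs: "xs \<in> ?T" for xs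
  proof -
    obtain M where "M \<in> carrier ?C" "M *v a = invariant \<phi> xs"
      using centralizer_transitive[OF phi a cyclic_vector_invariant[OF phi xs]] .
    then show ?thesis
      using r_coset_centralizer_eq[OF phi a, of M] by (auto simp: F_def)
  qed
  have "(xs, ys) \<in> nielsen_equivalence (semidirect \<phi>) 2 \<longleftrightarrow> F xs = F ys"
    if xs: "xs \<in> ?T" and ys: "ys \<in> ?T" for xs ys
    unfolding nielsen_equivalence_iff[OF phi xs ys]
  proof
    assume "\<exists>M\<in>signed_powers \<phi>. invariant \<phi> ys = M *v invariant \<phi> xs"
    then obtain M where M: "M \<in> signed_powers \<phi>" "invariant \<phi> ys = M *v invariant \<phi> xs" by blast
    obtain N where N: "N \<in> signed_powers \<phi>" "N ** M = mat 1"
      using signed_powers_inverse[OF phi M(1)] .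
    \<comment> \<open>Right multiplication by \<open>N\<close> and by \<open>M\<close> exchanges the
      witnesses \<open>S\<close> for the two invariants.\<close>
    have "S *v invariant \<phi> xs = (S ** N) *v invariant \<phi> ys" for S
      by (simp add: M(2) N(2) matrix_vector_mul_assoc flip: matrix_mul_assoc)
    moreover have "S *v invariant \<phi> ys = (S ** M) *v invariant \<phi> xs" for S
      by (simp add: M(2) matrix_vector_mul_assoc)
    ultimately have "(\<exists>S\<in>signed_powers \<phi>. u = S *v invariant \<phi> xs) \<longleftrightarrow>
        (\<exists>S\<in>signed_powers \<phi>. u = S *v invariant \<phi> ys)" for u
      using signed_powers_mult[OF phi _ M(1)] signed_powers_mult[OF phi _ N(1)] by blast
    then show "F xs = F ys"
      by (simp add: F_def)
  next
    assume eq: "F xs = F ys"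
    obtain M where "M \<in> carrier ?C" "M *v a = invariant \<phi> ys"
      using coset[OF ys] by blast
    \<comment> \<open>Here \<open>S = mat 1\<close> is the witness; membership in
      \<open>F xs\<close> then yields the signed power relating the invariants.\<close>
    then have "M \<in> F ys"
      using bexI[OF _ one_signed[OF phi]] by (simp add: F_def)
    then have "M \<in> F xs"
      by (simp only: eq)
    with \<open>M *v a = invariant \<phi> ys\<close>
    show "\<exists>M\<in>signed_powers \<phi>. invariant \<phi> ys = M *v invariant \<phi> xs"
      by (simp add: F_def)
  qed
  then have "nielsen_classes (semidirect \<phi>) 2 \<approx> F ` ?T"
    unfolding nielsen_classes_def
    by (intro eqpoll_quotient_image equiv_nielsen_equivalence group_semidirect phi)
  moreover have "F ` ?T = rcosets\<^bsub>?C\<^esub> (signed_powers \<phi>)"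
  proof (intro equalityI subsetI)
    fix K assume "K \<in> F ` ?T"
    then show "K \<in> rcosets\<^bsub>?C\<^esub> (signed_powers \<phi>)"
      using coset by (auto simp: RCOSETS_def)
  next
    fix K assume "K \<in> rcosets\<^bsub>?C\<^esub> (signed_powers \<phi>)"
    then obtain M where M: "M \<in> carrier ?C" "K = signed_powers \<phi> #>\<^bsub>?C\<^esub> M"
      by (auto simp: RCOSETS_def)
    \<comment> \<open>A pair realizing the coset of \<open>M\<close>: its invariant is
      \<open>M *v a\<close>, and it generates because this vector is again cyclic.\<close>
    let ?xs = "[(M *v a, 0), (0, 1)]"
    have "?xs \<in> ?T"
      by (intro cyclic_vector_imp_generating cyclic_vector_centralizer phi a M)
    moreover have "K = F ?xs"
      using r_coset_centralizer_eq[OF phi a M(1)] M(2)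
      by (simp add: F_def invariant_normal_form[OF phi])
    ultimately show "K \<in> F ` ?T" by blast
  qed
  ultimately show ?thesis
    by (simp add: generate_centralizer[OF phi])
qed

end
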